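(* Let $p$ be a prime, let $N\ge 1$ be an integer and let $x$ be a complex number with $x\ne 1$. Then $$\sum_{n=1}^{N}\Delta(n,p)\,x^{n}=\sum_{m=1}^{\lfloor N/p\rfloor}\varphi(pm)\,\frac{x^{pm}-x^{N+1}}{1-x}.$$ Moreover, for $x=1$ the identity holds in the limiting sense: $$\sum_{n=1}^{N}\Delta(n,p)=\sum_{m=1}^{\lfloor N/p\rfloor}\varphi(pm)\,(N-pm+1).$$
   Context: Here $\varphi$ denotes Euler's totient function, and for a prime $p$ and real $t\ge 1$, $\Delta(t,p)=\sum_{\substack{k\le t\\ p\mid k}}\varphi(k)$, the sum being over positive integers $k\le t$ divisible by $p$. Empty sums are $0$. *)

theory Defs
  imports "HOL-Analysis.Analysis" "HOL-Number_Theory.Totient"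
begin

definition Delta :: "real \<Rightarrow> nat \<Rightarrow> nat" where
  "Delta t p = (\<Sum>k \<in> {k. 1 \<le> k \<and> real k \<le> t \<and> p dvd k}. totient k)"

end

theory Submission
  imports Defs
begin

text \<open>
  The identity is an exchange of the order of summation. The positive multiples of \<open>p\<close> up to
  \<open>n\<close> are the numbers \<open>p * m\<close>, so \<open>\<phi>(p * m)\<close> enters \<open>\<Delta>(n, p)\<close> exactly for the \<open>n\<close> with
  \<open>p * m \<le> n\<close>. Weighting \<open>\<Delta>(n, p)\<close> by \<open>f n\<close> and summing over \<open>n \<le> N\<close>, each \<open>\<phi>(p * m)\<close>
  therefore picks up the tail sum of \<open>f\<close> over \<open>p * m \<le> n \<le> N\<close>
  (lemma \<open>sum_Delta_weighted\<close>).

  For \<open>f n = x ^ n\<close> with \<open>x \<noteq> 1\<close> the tail is a geometric sum, which gives the closed form; for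
  \<open>f n = 1\<close> it counts \<open>N - p * m + 1\<close> terms. The limit at \<open>1\<close> exists because away from \<open>1\<close> the
  closed form agrees with a polynomial in \<open>x\<close>, which is continuous.
\<close>

lemma Delta_eq_sum_multiples:
  assumes "p > 0" and "n \<le> N"
  shows "Delta (real n) p = (\<Sum>m | m \<in> {1..N div p} \<and> p * m \<le> n. totient (p * m))"
  unfolding Delta_def
proof (rule sum.reindex_bij_witness[where i = "\<lambda>m. p * m" and j = "\<lambda>k. k div p"])
  fix k assume k: "k \<in> {k. 1 \<le> k \<and> real k \<le> real n \<and> p dvd k}"
  then have "k div p \<le> N div p"
    using assms by (intro div_le_mono) auto
  with k show "k div p \<in> {m. m \<in> {1..N div p} \<and> p * m \<le> n}"
    using assms by (auto elim!: dvdE)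
qed (use assms in auto)

text \<open>
  Stated for an arbitrary weight over an arbitrary semiring, so that it covers both the complex
  generating function and the unweighted integer sum.
\<close>

lemma sum_Delta_weighted:
  fixes f :: "nat \<Rightarrow> 'a::comm_semiring_1"
  assumes "p > 0"
  shows "(\<Sum>n=1..N. of_nat (Delta (real n) p) * f n) =
         (\<Sum>m=1..N div p. of_nat (totient (p * m)) * (\<Sum>n=p*m..N. f n))"
proof -
  have "(\<Sum>n=1..N. of_nat (Delta (real n) p) * f n) =
        (\<Sum>n=1..N. \<Sum>m | m \<in> {1..N div p} \<and> p * m \<le> n. of_nat (totient (p * m)) * f n)"
    using assms by (intro sum.cong refl) (simp add: Delta_eq_sum_multiples[where N = N] sum_distrib_right)
  also have "\<dots> =
        (\<Sum>m=1..N div p. \<Sum>n | n \<in> {1..N} \<and> p * m \<le> n. of_nat (totient (p * m)) * f n)"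
    by (rule sum.swap_restrict) auto
  also have "\<dots> = (\<Sum>m=1..N div p. of_nat (totient (p * m)) * (\<Sum>n=p*m..N. f n))"
  proof (rule sum.cong[OF refl])
    fix m assume "m \<in> {1..N div p}"
    then have "1 \<le> n" if "p * m \<le> n" for n
      using assms that by (cases n) auto
    then have "{n. n \<in> {1..N} \<and> p * m \<le> n} = {p*m..N}"
      by auto
    then show "(\<Sum>n | n \<in> {1..N} \<and> p * m \<le> n. of_nat (totient (p * m)) * f n) =
               of_nat (totient (p * m)) * (\<Sum>n=p*m..N. f n)"
      by (simp add: sum_distrib_left)
  qed
  finally show ?thesis .
qed

lemma mult_le_of_le_div:
  fixes p m N :: nat
  assumes "m \<in> {1..N div p}"
  shows "p * m \<le> N"
proof -
  have "p * m \<le> p * (N div p)"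
    using assms by (intro mult_le_mono2) simp
  then show ?thesis
    using times_div_less_eq_dividend[of p N] by linarith
qed

theorem proposition4p3:
  fixes p N :: nat
  assumes "prime p" and "N \<ge> 1"
  shows "(\<forall>x::complex. x \<noteq> 1 \<longrightarrow>
            (\<Sum>n=1..N. of_nat (Delta (real n) p) * x ^ n) =
            (\<Sum>m=1..N div p. of_nat (totient (p * m)) * ((x ^ (p * m) - x ^ (N + 1)) / (1 - x))))
       \<and> ((\<lambda>x::complex. \<Sum>m=1..N div p. of_nat (totient (p * m)) * ((x ^ (p * m) - x ^ (N + 1)) / (1 - x)))
            \<longlongrightarrow> (\<Sum>n=1..N. of_nat (Delta (real n) p))) (at 1)
       \<and> (\<Sum>n=1..N. int (Delta (real n) p)) =
            (\<Sum>m=1..N div p. int (totient (p * m)) * (int N - int (p * m) + 1))"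
proof -
  have p: "p > 0"
    using assms(1) by (rule prime_gt_0_nat)
  let ?L = "\<lambda>x::complex. \<Sum>n=1..N. of_nat (Delta (real n) p) * x ^ n"
  let ?R = "\<lambda>x::complex.
    \<Sum>m=1..N div p. of_nat (totient (p * m)) * ((x ^ (p * m) - x ^ (N + 1)) / (1 - x))"
  have eq: "?L x = ?R x" if "x \<noteq> 1" for x
    unfolding sum_Delta_weighted[OF p]
  proof (rule sum.cong[OF refl])
    fix m assume "m \<in> {1..N div p}"
    then have "p * m \<le> N"
      by (rule mult_le_of_le_div)
    then show "of_nat (totient (p * m)) * (\<Sum>n=p*m..N. x ^ n) =
               of_nat (totient (p * m)) * ((x ^ (p * m) - x ^ (N + 1)) / (1 - x))"
      using that by (simp add: sum_gp)
  qed
  have "(?L \<longlongrightarrow> ?L 1) (at 1)"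
    by (intro tendsto_intros)
  moreover have "\<forall>\<^sub>F x in at 1. ?L x = ?R x"
    using eq by (auto simp: eventually_at_filter)
  ultimately have "(?R \<longlongrightarrow> ?L 1) (at 1)"
    by (rule Lim_transform_eventually)
  then have lim: "(?R \<longlongrightarrow> (\<Sum>n=1..N. of_nat (Delta (real n) p))) (at 1)"
    by simp
  have "(\<Sum>n=1..N. int (Delta (real n) p)) =
        (\<Sum>m=1..N div p. int (totient (p * m)) * (\<Sum>n=p*m..N. 1))"
    using sum_Delta_weighted[OF p, where N = N and f = "\<lambda>_. 1 :: int"] by simp
  also have "\<dots> = (\<Sum>m=1..N div p. int (totient (p * m)) * (int N - int (p * m) + 1))"
  proof (rule sum.cong[OF refl])
    fix m assume "m \<in> {1..N div p}"
    then have "p * m \<le> N"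
      by (rule mult_le_of_le_div)
    then show "int (totient (p * m)) * (\<Sum>n=p*m..N. 1) =
               int (totient (p * m)) * (int N - int (p * m) + 1)"
      by (simp add: of_nat_diff Suc_diff_le del: of_nat_mult)
  qed
  finally show ?thesis
    using eq lim by blast
qed

end
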